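(* For every positive integer $n$ and every permutation $\pi\in S_k$, $L_n(\pi)=L_n(\pi^{\mathrm{rev}})=L_n(\pi^c)$, where $\pi^{\mathrm{rev}}(i)=\pi(k+1-i)$ is the reverse of $\pi$ and $\pi^c(i)=(k+1)-\pi(i)$ is the complement of $\pi$.
   Context: An $n$-th order Latin Square is an $n\times n$ grid filled with the symbols $1,\dots,n$ such that each symbol appears exactly once in each row and each column. Rows read left to right and columns read top to bottom give permutations of $\{1,\dots,n\}$. A permutation contains a pattern $\pi$ if some subsequence is order isomorphic to $\pi$, and avoids it otherwise. A Latin Square avoids $\pi$ if all its row and column permutations avoid $\pi$; $L_n(\pi)$ denotes the number of $n$-th order Latin Squares avoiding $\pi$. *)

theory Defs
  imports Main "HOL-Library.FuncSet" "HOL-Combinatorics.Permutations"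
begin

text \<open>
  An element of $S_k$ is a function \<open>p\<close> with \<open>p permutes {1..k}\<close>. Since such a
  function does not determine \<open>k\<close>, the length is passed along explicitly.
\<close>

definition contains_pattern :: "nat \<Rightarrow> (nat \<Rightarrow> nat) \<Rightarrow> nat \<Rightarrow> (nat \<Rightarrow> nat) \<Rightarrow> bool" where
  "contains_pattern n \<sigma> k \<pi> \<longleftrightarrow>
     (\<exists>f. strict_mono_on {1..k} f \<and> f ` {1..k} \<subseteq> {1..n} \<and>
        (\<forall>a\<in>{1..k}. \<forall>b\<in>{1..k}. \<sigma> (f a) < \<sigma> (f b) \<longleftrightarrow> \<pi> a < \<pi> b))"

text \<open>
  The entry in row \<open>i\<close> and column \<open>j\<close> is \<open>A (i, j)\<close>. Taking \<open>A\<close> extensional makes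
  distinct functions represent distinct squares, so that squares can be counted.
\<close>

definition latin_square :: "nat \<Rightarrow> (nat \<times> nat \<Rightarrow> nat) \<Rightarrow> bool" where
  "latin_square n A \<longleftrightarrow>
     A \<in> ({1..n} \<times> {1..n}) \<rightarrow>\<^sub>E {1..n} \<and>
     (\<forall>i\<in>{1..n}. \<forall>s\<in>{1..n}. \<exists>!j. j \<in> {1..n} \<and> A (i, j) = s) \<and>
     (\<forall>j\<in>{1..n}. \<forall>s\<in>{1..n}. \<exists>!i. i \<in> {1..n} \<and> A (i, j) = s)"

definition latin_square_avoids ::
    "nat \<Rightarrow> (nat \<times> nat \<Rightarrow> nat) \<Rightarrow> nat \<Rightarrow> (nat \<Rightarrow> nat) \<Rightarrow> bool" where
  "latin_square_avoids n A k \<pi> \<longleftrightarrow>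
     (\<forall>i\<in>{1..n}. \<not> contains_pattern n (\<lambda>j. A (i, j)) k \<pi>) \<and>
     (\<forall>j\<in>{1..n}. \<not> contains_pattern n (\<lambda>i. A (i, j)) k \<pi>)"

definition num_latin_avoiding :: "nat \<Rightarrow> nat \<Rightarrow> (nat \<Rightarrow> nat) \<Rightarrow> nat" where
  "num_latin_avoiding n k \<pi> = card {A. latin_square n A \<and> latin_square_avoids n A k \<pi>}"

text \<open>Outside \<open>{1..k}\<close> the reverse and complement are the identity, as \<open>permutes\<close> requires.\<close>

definition pattern_reverse :: "nat \<Rightarrow> (nat \<Rightarrow> nat) \<Rightarrow> nat \<Rightarrow> nat" where
  "pattern_reverse k \<pi> = (\<lambda>i. if i \<in> {1..k} then \<pi> (k + 1 - i) else i)"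

definition pattern_complement :: "nat \<Rightarrow> (nat \<Rightarrow> nat) \<Rightarrow> nat \<Rightarrow> nat" where
  "pattern_complement k \<pi> = (\<lambda>i. if i \<in> {1..k} then (k + 1) - \<pi> i else i)"

lemma finite_latin_squares: "finite {A. latin_square n A \<and> P A}"
  by (rule finite_subset[OF _ finite_PiE[of "{1..n} \<times> {1..n}" "\<lambda>_. {1..n}"]])
     (auto simp: latin_square_def)

lemma bij_betw_reflect: "bij_betw (\<lambda>i. k + 1 - i) {1..k} {1..k::nat}"
  by (rule bij_betw_byWitness[where f' = "\<lambda>i. k + 1 - i"]) auto

lemma pattern_reverse_permutes:
  assumes "\<pi> permutes {1..k}"
  shows "pattern_reverse k \<pi> permutes {1..k}"
proof (rule bij_imp_permutes)
  have "bij_betw (\<pi> \<circ> (\<lambda>i. k + 1 - i)) {1..k} {1..k}"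
    by (rule bij_betw_trans[OF bij_betw_reflect permutes_imp_bij[OF assms]])
  then show "bij_betw (pattern_reverse k \<pi>) {1..k} {1..k}"
    by (rule bij_betw_cong[THEN iffD1, rotated]) (simp add: pattern_reverse_def)
qed (auto simp: pattern_reverse_def)

lemma pattern_complement_permutes:
  assumes "\<pi> permutes {1..k}"
  shows "pattern_complement k \<pi> permutes {1..k}"
proof (rule bij_imp_permutes)
  have "bij_betw ((\<lambda>i. k + 1 - i) \<circ> \<pi>) {1..k} {1..k}"
    by (rule bij_betw_trans[OF permutes_imp_bij[OF assms] bij_betw_reflect])
  then show "bij_betw (pattern_complement k \<pi>) {1..k} {1..k}"
    by (rule bij_betw_cong[THEN iffD1, rotated]) (simp add: pattern_complement_def)
qed (auto simp: pattern_complement_def)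

end

theory Submission
  imports Defs
begin

text \<open>
  Rotating a square by 180 degrees reverses every row and every column, and replacing each
  entry \<open>a\<close> by \<open>n + 1 - a\<close> complements them. Both maps are injective on Latin squares, which
  gives one inequality between the counts; the other one follows by applying it to the
  reversed or complemented pattern.
\<close>

text \<open>Existence of preimages is surjectivity and their uniqueness is injectivity. The
  assumption \<open>f \<in> S \<rightarrow> T\<close> puts each value \<open>f x\<close> among the
  points where uniqueness is available.\<close>

lemma ex1_preimage_iff_bij_betw:
  assumes "f \<in> S \<rightarrow> T"
  shows "(\<forall>s\<in>T. \<exists>!j. j \<in> S \<and> f j = s) \<longleftrightarrow> bij_betw f S T"
proof
  assume L: "\<forall>s\<in>T. \<exists>!j. j \<in> S \<and> f j = s"
  have "inj_on f S"
  proof (rule inj_onI)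
    fix x y assume "x \<in> S" "y \<in> S" "f x = f y"
    moreover from this have "\<exists>!j. j \<in> S \<and> f j = f y"
      using L assms by blast
    ultimately show "x = y" by blast
  qed
  moreover have "f ` S = T"
    using L assms by blast
  ultimately show "bij_betw f S T"
    by (simp add: bij_betw_def)
next
  assume "bij_betw f S T"
  then show "\<forall>s\<in>T. \<exists>!j. j \<in> S \<and> f j = s"
    by (auto simp: bij_betw_def inj_on_def)
qed

text \<open>With lines of the square seen as bijections, permuting rows, columns or symbols becomes
  composition of bijections.\<close>

lemma latin_square_iff_bij_betw:
  "latin_square n A \<longleftrightarrow>
     A \<in> ({1..n} \<times> {1..n}) \<rightarrow>\<^sub>E {1..n} \<and>
     (\<forall>i\<in>{1..n}. bij_betw (\<lambda>j. A (i, j)) {1..n} {1..n}) \<and>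
     (\<forall>j\<in>{1..n}. bij_betw (\<lambda>i. A (i, j)) {1..n} {1..n})"
\<comment> \<open>If the common first conjunct fails, both sides are false; otherwise it supplies
  the range condition for every row and column.\<close>
proof (cases "A \<in> ({1..n} \<times> {1..n}) \<rightarrow>\<^sub>E {1..n}")
  case True
  then have val: "A (i, j) \<in> {1..n}" if "i \<in> {1..n}" "j \<in> {1..n}" for i j
    using that by (rule PiE_mem[OF _ SigmaI])
  have "(\<forall>s\<in>{1..n}. \<exists>!j. j \<in> {1..n} \<and> A (i, j) = s) \<longleftrightarrow> bij_betw (\<lambda>j. A (i, j)) {1..n} {1..n}"
    if "i \<in> {1..n}" for i
    by (rule ex1_preimage_iff_bij_betw, rule Pi_I, rule val[OF that])
  moreover have "(\<forall>s\<in>{1..n}. \<exists>!i. i \<in> {1..n} \<and> A (i, j) = s) \<longleftrightarrow> bij_betw (\<lambda>i. A (i, j)) {1..n} {1..n}"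
    if "j \<in> {1..n}" for j
    by (rule ex1_preimage_iff_bij_betw, rule Pi_I, rule val[OF _ that])
  ultimately show ?thesis
    using True by (simp only: latin_square_def cong: ball_cong)
qed (simp only: latin_square_def simp_thms)

text \<open>The usual isotopy of Latin squares. Rotation takes the reflection for \<open>r\<close>
  and \<open>c\<close> and \<open>id\<close> for \<open>s\<close>; complementation takes
  \<open>id\<close>, \<open>id\<close> and the reflection. \<open>restrict\<close> keeps the result
  extensional, as \<open>latin_square\<close> demands.\<close>

definition isotope ::
    "nat \<Rightarrow> (nat \<Rightarrow> nat) \<Rightarrow> (nat \<Rightarrow> nat) \<Rightarrow> (nat \<Rightarrow> nat) \<Rightarrow> (nat \<times> nat \<Rightarrow> nat) \<Rightarrow> nat \<times> nat \<Rightarrow> nat" where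
  "isotope n r c s A = restrict (\<lambda>(i, j). s (A (r i, c j))) ({1..n} \<times> {1..n})"

text \<open>Row \<open>i\<close> of the new square is \<open>c\<close> followed by row
  \<open>r i\<close> of \<open>A\<close> followed by \<open>s\<close>, a composition of bijections
  of \<open>{1..n}\<close>; columns are symmetric.\<close>

lemma latin_square_isotope:
  assumes "latin_square n A" and r: "bij_betw r {1..n} {1..n}"
    and c: "bij_betw c {1..n} {1..n}" and s: "bij_betw s {1..n} {1..n}"
  shows "latin_square n (isotope n r c s A)"
  unfolding latin_square_iff_bij_betw
proof (intro conjI ballI)
  have A: "A \<in> ({1..n} \<times> {1..n}) \<rightarrow>\<^sub>E {1..n}"
    and rows: "\<And>i. i \<in> {1..n} \<Longrightarrow> bij_betw (\<lambda>j. A (i, j)) {1..n} {1..n}"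
    and cols: "\<And>j. j \<in> {1..n} \<Longrightarrow> bij_betw (\<lambda>i. A (i, j)) {1..n} {1..n}"
    using assms(1) unfolding latin_square_iff_bij_betw by blast+
  have mem: "r i \<in> {1..n}" "c i \<in> {1..n}" "s i \<in> {1..n}" if "i \<in> {1..n}" for i
    using that r c s by (blast dest: bij_betwE)+
  have val: "A (i, j) \<in> {1..n}" if "i \<in> {1..n}" "j \<in> {1..n}" for i j
    using A that by (auto dest: PiE_mem)
  show "isotope n r c s A \<in> ({1..n} \<times> {1..n}) \<rightarrow>\<^sub>E {1..n}"
    unfolding isotope_def restrict_PiE_iff
  proof
    fix x :: "nat \<times> nat"
    assume "x \<in> {1..n} \<times> {1..n}"
    then have "s (A (r (fst x), c (snd x))) \<in> {1..n}"
      by (intro mem val) (simp_all only: mem_Times_iff)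
    then show "(case x of (i, j) \<Rightarrow> s (A (r i, c j))) \<in> {1..n}"
      by (simp only: case_prod_beta)
  qed
  show "bij_betw (\<lambda>j. isotope n r c s A (i, j)) {1..n} {1..n}" if "i \<in> {1..n}" for i
    using bij_betw_trans[OF bij_betw_trans[OF c rows[OF mem(1)[OF that]]] s]
    by (rule bij_betw_cong[THEN iffD1, rotated]) (use that in \<open>simp add: isotope_def\<close>)
  show "bij_betw (\<lambda>i. isotope n r c s A (i, j)) {1..n} {1..n}" if "j \<in> {1..n}" for j
    using bij_betw_trans[OF bij_betw_trans[OF r cols[OF mem(2)[OF that]]] s]
    by (rule bij_betw_cong[THEN iffD1, rotated]) (use that in \<open>simp add: isotope_def\<close>)
qed

lemma inj_on_isotope:
  assumes r: "bij_betw r {1..n} {1..n}"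
    and c: "bij_betw c {1..n} {1..n}" and s: "bij_betw s {1..n} {1..n}"
  shows "inj_on (isotope n r c s) {A. latin_square n A}"
proof (rule inj_onI, clarify)
  fix A B
  assume A: "latin_square n A" and B: "latin_square n B"
    and eq: "isotope n r c s A = isotope n r c s B"
  show "A = B"
  proof (rule PiE_ext)
    show AE: "A \<in> ({1..n} \<times> {1..n}) \<rightarrow>\<^sub>E {1..n}" and BE: "B \<in> ({1..n} \<times> {1..n}) \<rightarrow>\<^sub>E {1..n}"
      using A B by (auto simp: latin_square_def)
    fix x :: "nat \<times> nat"
    assume x: "x \<in> {1..n} \<times> {1..n}"
    \<comment> \<open>Since \<open>r\<close> and \<open>c\<close> are onto, every cell
      \<open>x\<close> is read by some cell \<open>(i, j)\<close> of the isotope; injectivity of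
      \<open>s\<close> then recovers the entry at \<open>x\<close>.\<close>
    then have "fst x \<in> r ` {1..n}" "snd x \<in> c ` {1..n}"
      using r c by (auto simp only: bij_betw_def mem_Times_iff)
    then obtain i j where ij: "i \<in> {1..n}" "j \<in> {1..n}" "x = (r i, c j)"
      by (metis imageE prod.collapse)
    have "s (A x) = s (B x)"
      using fun_cong[OF eq, of "(i, j)"] ij by (simp add: isotope_def)
    then show "A x = B x"
      using s PiE_mem[OF AE x] PiE_mem[OF BE x] by (meson bij_betw_def inj_onD)
  qed
qed

lemma contains_pattern_mirror:
  assumes "contains_pattern n \<tau> k (pattern_reverse k \<pi>)"
    and \<tau>: "\<And>i. i \<in> {1..n} \<Longrightarrow> \<tau> i = \<sigma> (n + 1 - i)"
  shows "contains_pattern n \<sigma> k \<pi>"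
proof -
  obtain f where f: "strict_mono_on {1..k} f" "f ` {1..k} \<subseteq> {1..n}"
    and iff: "\<And>a b. a \<in> {1..k} \<Longrightarrow> b \<in> {1..k} \<Longrightarrow>
      \<tau> (f a) < \<tau> (f b) \<longleftrightarrow> pattern_reverse k \<pi> a < pattern_reverse k \<pi> b"
    using assms(1) by (auto simp: contains_pattern_def)
  \<comment> \<open>The occurrence \<open>f\<close> read backwards: the outer reflection turns
    positions in \<tau> into positions in \<sigma>, the inner one undoes the reversal of \<pi>. Two
    order reversals together keep \<open>g\<close> increasing.\<close>
  define g where "g = (\<lambda>a. n + 1 - f (k + 1 - a))"
  have refl: "k + 1 - a \<in> {1..k}" if "a \<in> {1..k}" for a
    using that by auto
  have fb: "f a \<in> {1..n}" if "a \<in> {1..k}" for a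
    using f(2) that by blast
  have "strict_mono_on {1..k} g"
  proof (rule strict_mono_onI)
    fix a b assume ab: "a \<in> {1..k}" "b \<in> {1..k}" "a < b"
    then have "f (k + 1 - b) < f (k + 1 - a)"
      by (intro strict_mono_onD[OF f(1)]) auto
    then show "g a < g b"
      using fb[OF refl[OF ab(1)]] fb[OF refl[OF ab(2)]] unfolding g_def by auto
  qed
  moreover have "g ` {1..k} \<subseteq> {1..n}"
    using fb refl by (fastforce simp: g_def)
  moreover have "\<sigma> (g a) < \<sigma> (g b) \<longleftrightarrow> \<pi> a < \<pi> b" if "a \<in> {1..k}" "b \<in> {1..k}" for a b
  proof -
    have "\<tau> (f (k + 1 - x)) = \<sigma> (g x)" if "x \<in> {1..k}" for x
      using \<tau>[OF fb[OF refl[OF that]]] by (simp only: g_def)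
    moreover have "pattern_reverse k \<pi> (k + 1 - x) = \<pi> x" if "x \<in> {1..k}" for x
      using that by (auto simp: pattern_reverse_def)
    ultimately show ?thesis
      using iff[OF refl refl, OF that] that by simp
  qed
  ultimately show ?thesis
    unfolding contains_pattern_def by blast
qed

text \<open>The same positions \<open>f\<close> serve for both words, because complementing the word
  and the pattern flips every comparison on both sides.\<close>

lemma contains_pattern_complement:
  assumes "contains_pattern n \<tau> k (pattern_complement k \<pi>)"
    and \<tau>: "\<And>i. i \<in> {1..n} \<Longrightarrow> \<tau> i = n + 1 - \<sigma> i"
    and \<sigma>: "\<And>i. i \<in> {1..n} \<Longrightarrow> \<sigma> i \<in> {1..n}"
    and \<pi>: "\<pi> permutes {1..k}"
  shows "contains_pattern n \<sigma> k \<pi>"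
proof -
  obtain f where f: "strict_mono_on {1..k} f" "f ` {1..k} \<subseteq> {1..n}"
    and iff: "\<And>a b. a \<in> {1..k} \<Longrightarrow> b \<in> {1..k} \<Longrightarrow>
      \<tau> (f a) < \<tau> (f b) \<longleftrightarrow> pattern_complement k \<pi> a < pattern_complement k \<pi> b"
    using assms(1) by (auto simp: contains_pattern_def)
  have "\<sigma> (f a) < \<sigma> (f b) \<longleftrightarrow> \<pi> a < \<pi> b" if ab: "a \<in> {1..k}" "b \<in> {1..k}" for a b
  proof -
    have fb: "f a \<in> {1..n}" "f b \<in> {1..n}"
      using f(2) ab by blast+
    have p: "\<pi> a \<in> {1..k}" "\<pi> b \<in> {1..k}"
      using ab permutes_in_image[OF \<pi>] by blast+
    \<comment> \<open>\<open>iff\<close> is used with \<open>a\<close> and \<open>b\<close>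
      exchanged to offset the flip. Subtraction on naturals truncates, so cancelling the reflections
      afterwards relies on the ranges of \<sigma> and \<pi>.\<close>
    have "n + 1 - \<sigma> (f b) < n + 1 - \<sigma> (f a) \<longleftrightarrow> k + 1 - \<pi> b < k + 1 - \<pi> a"
      using iff[OF ab(2,1)] ab by (simp only: \<tau>[OF fb(1)] \<tau>[OF fb(2)] pattern_complement_def if_True)
    then show ?thesis
      using \<sigma>[OF fb(1)] \<sigma>[OF fb(2)] p by auto
  qed
  then show ?thesis
    using f unfolding contains_pattern_def by blast
qed

text \<open>An isotopy is injective on Latin squares, so comparing the counts reduces to checking
  that it carries avoidance of \<pi> to avoidance of \<rho>.\<close>

lemma num_latin_avoiding_mono_isotope:
  assumes "bij_betw r {1..n} {1..n}" "bij_betw c {1..n} {1..n}" "bij_betw s {1..n} {1..n}"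
    and "\<And>A. latin_square n A \<Longrightarrow> latin_square_avoids n A k \<pi> \<Longrightarrow>
           latin_square_avoids n (isotope n r c s A) k \<rho>"
  shows "num_latin_avoiding n k \<pi> \<le> num_latin_avoiding n k \<rho>"
  unfolding num_latin_avoiding_def
proof (rule card_inj_on_le[OF _ _ finite_latin_squares])
  show "inj_on (isotope n r c s) {A. latin_square n A \<and> latin_square_avoids n A k \<pi>}"
    by (rule inj_on_subset[OF inj_on_isotope[OF assms(1-3)]]) auto
  show "isotope n r c s ` {A. latin_square n A \<and> latin_square_avoids n A k \<pi>}
      \<subseteq> {A. latin_square n A \<and> latin_square_avoids n A k \<rho>}"
    using assms(4) latin_square_isotope[OF _ assms(1-3)] by blast
qed

lemma num_latin_avoiding_le_reverse:
  "num_latin_avoiding n k \<pi> \<le> num_latin_avoiding n k (pattern_reverse k \<pi>)"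
\<comment> \<open>Both coordinates are reflected because avoidance concerns rows and columns:
  reflecting \<open>j\<close> alone would reverse the rows but only permute the columns among
  themselves.\<close>
proof (rule num_latin_avoiding_mono_isotope[OF bij_betw_reflect bij_betw_reflect bij_betw_id])
  fix A
  let ?B = "isotope n (\<lambda>i. n + 1 - i) (\<lambda>i. n + 1 - i) id A"
  assume avoids: "latin_square_avoids n A k \<pi>"
  \<comment> \<open>Row \<open>i\<close> of \<open>?B\<close> is row \<open>n + 1 - i\<close> of
    \<open>A\<close> read from right to left.\<close>
  have "\<not> contains_pattern n (\<lambda>j. ?B (i, j)) k (pattern_reverse k \<pi>)" if i: "i \<in> {1..n}" for i
  proof
    assume "contains_pattern n (\<lambda>j. ?B (i, j)) k (pattern_reverse k \<pi>)"
    then have "contains_pattern n (\<lambda>j. A (n + 1 - i, j)) k \<pi>"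
      by (rule contains_pattern_mirror) (use i in \<open>simp add: isotope_def\<close>)
    moreover have "n + 1 - i \<in> {1..n}"
      using i by auto
    ultimately show False
      using avoids unfolding latin_square_avoids_def by blast
  qed
  moreover have "\<not> contains_pattern n (\<lambda>i. ?B (i, j)) k (pattern_reverse k \<pi>)" if j: "j \<in> {1..n}" for j
  proof
    assume "contains_pattern n (\<lambda>i. ?B (i, j)) k (pattern_reverse k \<pi>)"
    then have "contains_pattern n (\<lambda>i. A (i, n + 1 - j)) k \<pi>"
      by (rule contains_pattern_mirror) (use j in \<open>simp add: isotope_def\<close>)
    moreover have "n + 1 - j \<in> {1..n}"
      using j by auto
    ultimately show False
      using avoids unfolding latin_square_avoids_def by blast
  qed
  ultimately show "latin_square_avoids n ?B k (pattern_reverse k \<pi>)"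
    by (simp add: latin_square_avoids_def)
qed

lemma num_latin_avoiding_le_complement:
  assumes "\<pi> permutes {1..k}"
  shows "num_latin_avoiding n k \<pi> \<le> num_latin_avoiding n k (pattern_complement k \<pi>)"
proof (rule num_latin_avoiding_mono_isotope[OF bij_betw_id bij_betw_id bij_betw_reflect])
  fix A
  let ?B = "isotope n id id (\<lambda>i. n + 1 - i) A"
  assume "latin_square n A" and avoids: "latin_square_avoids n A k \<pi>"
  then have "A \<in> ({1..n} \<times> {1..n}) \<rightarrow>\<^sub>E {1..n}"
    by (simp add: latin_square_def)
  then have val: "A (i, j) \<in> {1..n}" if "i \<in> {1..n}" "j \<in> {1..n}" for i j
    using that by (auto dest: PiE_mem)
  \<comment> \<open>Only symbols change here, so each line of \<open>?B\<close> is compared with the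
    line of \<open>A\<close> in the same place.\<close>
  have "\<not> contains_pattern n (\<lambda>j. ?B (i, j)) k (pattern_complement k \<pi>)" if i: "i \<in> {1..n}" for i
  proof
    assume "contains_pattern n (\<lambda>j. ?B (i, j)) k (pattern_complement k \<pi>)"
    then have "contains_pattern n (\<lambda>j. A (i, j)) k \<pi>"
      by (rule contains_pattern_complement[OF _ _ val[OF i] assms])
         (use i in \<open>simp_all add: isotope_def\<close>)
    then show False
      using avoids i unfolding latin_square_avoids_def by blast
  qed
  moreover have "\<not> contains_pattern n (\<lambda>i. ?B (i, j)) k (pattern_complement k \<pi>)" if j: "j \<in> {1..n}" for j
  proof
    assume "contains_pattern n (\<lambda>i. ?B (i, j)) k (pattern_complement k \<pi>)"
    then have "contains_pattern n (\<lambda>i. A (i, j)) k \<pi>"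
      by (rule contains_pattern_complement[OF _ _ val[OF _ j] assms])
         (use j in \<open>simp_all add: isotope_def\<close>)
    then show False
      using avoids j unfolding latin_square_avoids_def by blast
  qed
  ultimately show "latin_square_avoids n ?B k (pattern_complement k \<pi>)"
    by (simp add: latin_square_avoids_def)
qed

lemma pattern_reverse_reverse:
  assumes "\<pi> permutes {1..k}"
  shows "pattern_reverse k (pattern_reverse k \<pi>) = \<pi>"
  using permutes_not_in[OF assms] by (auto simp: pattern_reverse_def fun_eq_iff)

lemma pattern_complement_complement:
  assumes "\<pi> permutes {1..k}"
  shows "pattern_complement k (pattern_complement k \<pi>) = \<pi>"
proof
  fix i
  show "pattern_complement k (pattern_complement k \<pi>) i = \<pi> i"
    \<comment> \<open>Inside \<open>{1..k}\<close> the bound on \<open>\<pi> i\<close> makes the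
      truncated double subtraction return \<open>\<pi> i\<close>; outside, \<pi> is the identity,
      like the complement.\<close>
    using permutes_not_in[OF assms, of i] permutes_in_image[OF assms, of i]
    by (auto simp: pattern_complement_def)
qed

theorem theorem9:
  fixes n k :: nat and \<pi> :: "nat \<Rightarrow> nat"
  assumes "n \<ge> 1"
    and "\<pi> permutes {1..k}"
  shows "num_latin_avoiding n k \<pi> = num_latin_avoiding n k (pattern_reverse k \<pi>) \<and>
         num_latin_avoiding n k (pattern_reverse k \<pi>) = num_latin_avoiding n k (pattern_complement k \<pi>)"
proof -
  have "num_latin_avoiding n k \<pi> = num_latin_avoiding n k (pattern_reverse k \<pi>)"
    using num_latin_avoiding_le_reverse[of n k \<pi>]
      num_latin_avoiding_le_reverse[of n k "pattern_reverse k \<pi>"]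
    by (simp add: pattern_reverse_reverse[OF assms(2)])
  moreover have "num_latin_avoiding n k \<pi> = num_latin_avoiding n k (pattern_complement k \<pi>)"
    using num_latin_avoiding_le_complement[OF assms(2), of n]
      num_latin_avoiding_le_complement[OF pattern_complement_permutes[OF assms(2)], of n]
    by (simp add: pattern_complement_complement[OF assms(2)])
  ultimately show ?thesis
    by simp
qed

end
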